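(* Let $\lambda_0\ge 1$, $\lambda_1>0$ and $0<c<1/2$ be constants. Consider the first order homogeneous MECLTG $CG(V,\omega_1,p_0,p_1)$ with $|V|=n$, $p_0=\lambda_0/n$ and $p_1=1-\lambda_1n^{-c}$, and let $d_i$ be the degree of node $i$. For $\gamma>1$, $\mu>0$ define $M_\gamma$ and $M_{\gamma,\mu}$ by $\sum_{k=1}^n M_\gamma k^{-\gamma}=1$ and $\sum_{k=1}^n M_{\gamma,\mu}k^{-\gamma}\exp(-\mu k)=1$, and let $$A_{n,\gamma}=\Big\{k:\ n^{-1}\sum_{i=1}^n\mathbb P(d_i=k)\geq M_\gamma k^{-\gamma}\Big\},\qquad B_{n,\gamma,\mu}=\Big\{k:\ n^{-1}\sum_{i=1}^n\mathbb P(d_i=k)\geq M_{\gamma,\mu} k^{-\gamma}\exp(-\mu k)\Big\}.$$ Then for any $\gamma>1$ and $\mu>0$ there exist constants $a_0,b_0,c_0,d_0>0$ (not depending on $n$, possibly depending on $\gamma$) such that for all sufficiently large $n$, $$\left\{k\in\mathbb Z:\lfloor a_0n^{\frac{2c}{1+\gamma}}\rfloor\leq k\leq \lfloor b_0n^c\log n\rfloor\right\}\subset A_{n,\gamma},$$ $$\left\{k\in\mathbb Z:\lfloor c_0\log n\rfloor\leq k\leq \lfloor d_0n\rfloor\right\}\subset B_{n,\gamma,\mu}.$$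
   Context: First order homogeneous MECLTG (marginally edge constant latent time-order graph) $CG(V,\omega,p_0,p_1)$: a random undirected simple graph on $V=\{1,\dots,n\}$ with adjacency matrix $A$. Let $N=n(n-1)/2$ and let $\omega$ be a bijection from the unordered pairs $\{i,j\}$, $i\ne j$, onto $\{1,\dots,N\}$. The ordered edge variables $B_{\omega(\{i,j\})}=A_{i,j}$ form a stationary $\{0,1\}$-valued Markov chain $B_1,\dots,B_N$ with $\mathbb P(B_i=1\mid B_{i-1}=1)=p_1$, $\mathbb P(B_i=1\mid B_{i-1}=0)=p_0$ and $\mathbb P(B_j=1)=p:=p_0/(1+p_0-p_1)$ for all $1\le j\le N$. The order $\omega_1$: $\omega_1(\{i,j\})=n(i-1)-i(i-1)/2+j-i$ for $1\le i<j\le n$; i.e. the edge variables are generated in the order $A_{1,2},A_{1,3},\dots,A_{1,n},A_{2,3},\dots,A_{2,n},A_{3,4},\dots,A_{n-1,n}$. *)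

theory Defs
  imports "HOL-Probability.Probability"
begin

text \<open>Edge variables are boolean: \<open>True\<close> stands for the value 1 and \<open>False\<close> for 0.
  Conditional probabilities are only constrained where the conditioning event has positive
  probability. Stationarity is expressed by the constant marginals: for a chain with
  time-independent transition probabilities the two are the same.\<close>

definition stationary_binary_chain ::
  "'w measure \<Rightarrow> (nat \<Rightarrow> 'w \<Rightarrow> bool) \<Rightarrow> nat \<Rightarrow> real \<Rightarrow> real \<Rightarrow> bool" where
  "stationary_binary_chain M B N p0 p1 \<longleftrightarrow>
     prob_space M \<and>
     (\<forall>m\<in>{1..N}. B m \<in> measurable M (count_space UNIV)) \<and>
     (\<forall>m\<in>{1..<N}. \<forall>b. \<P>(w in M. \<forall>l\<in>{1..m}. B l w = b l) > 0 \<longrightarrow>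
        \<P>(w in M. B (Suc m) w \<bar> \<forall>l\<in>{1..m}. B l w = b l) = \<P>(w in M. B (Suc m) w \<bar> B m w = b m)) \<and>
     (\<forall>m\<in>{1..<N}. \<P>(w in M. B m w) > 0 \<longrightarrow> \<P>(w in M. B (Suc m) w \<bar> B m w) = p1) \<and>
     (\<forall>m\<in>{1..<N}. \<P>(w in M. \<not> B m w) > 0 \<longrightarrow> \<P>(w in M. B (Suc m) w \<bar> \<not> B m w) = p0) \<and>
     (\<forall>m\<in>{1..N}. \<P>(w in M. B m w) = p0 / (1 + p0 - p1))"

text \<open>\<open>MECLTG M A n \<omega> p0 p1\<close>: on the probability space \<open>M\<close>, the random adjacency matrix \<open>A\<close>
  (with \<open>A i j w\<close> saying that \<open>i\<close> and \<open>j\<close> are adjacent in the outcome \<open>w\<close>) is a first order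
  homogeneous MECLTG on the vertex set \<open>{1..n}\<close>.\<close>

definition MECLTG ::
  "'w measure \<Rightarrow> (nat \<Rightarrow> nat \<Rightarrow> 'w \<Rightarrow> bool) \<Rightarrow> nat \<Rightarrow> (nat set \<Rightarrow> nat) \<Rightarrow> real \<Rightarrow> real \<Rightarrow> bool" where
  "MECLTG M A n \<omega> p0 p1 \<longleftrightarrow>
     bij_betw \<omega> {e. e \<subseteq> {1..n} \<and> card e = 2} {1..n * (n - 1) div 2} \<and>
     (\<forall>w\<in>space M. \<forall>i\<in>{1..n}. \<not> A i i w) \<and>
     (\<exists>B. stationary_binary_chain M B (n * (n - 1) div 2) p0 p1 \<and>
          (\<forall>w\<in>space M. \<forall>i\<in>{1..n}. \<forall>j\<in>{1..n}. i \<noteq> j \<longrightarrow> B (\<omega> {i, j}) w = A i j w))"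

text \<open>For \<open>1 \<le> i < j \<le> n\<close> the truncated subtractions and the integer division below are exact.\<close>

definition omega1 :: "nat \<Rightarrow> nat set \<Rightarrow> nat" where
  "omega1 n e = (let i = Min e; j = Max e in n * (i - 1) - i * (i - 1) div 2 + j - i)"

definition node_degree :: "(nat \<Rightarrow> nat \<Rightarrow> 'w \<Rightarrow> bool) \<Rightarrow> nat \<Rightarrow> nat \<Rightarrow> 'w \<Rightarrow> nat" where
  "node_degree A n i w = card {j\<in>{1..n}. A i j w}"

definition avg_degree_prob ::
  "'w measure \<Rightarrow> (nat \<Rightarrow> nat \<Rightarrow> 'w \<Rightarrow> bool) \<Rightarrow> nat \<Rightarrow> int \<Rightarrow> real" where
  "avg_degree_prob M A n k = (\<Sum>i=1..n. \<P>(w in M. int (node_degree A n i w) = k)) / real n"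

definition M_pow :: "nat \<Rightarrow> real \<Rightarrow> real" where
  "M_pow n \<gamma> = (THE C. (\<Sum>k=1..n. C * real k powr (- \<gamma>)) = 1)"

definition M_powexp :: "nat \<Rightarrow> real \<Rightarrow> real \<Rightarrow> real" where
  "M_powexp n \<gamma> \<mu> = (THE C. (\<Sum>k=1..n. C * real k powr (- \<gamma>) * exp (- \<mu> * real k)) = 1)"

text \<open>The condition \<open>k \<ge> 1\<close> is needed because \<open>0 powr (- \<gamma>) = 0\<close>, which would make
  the defining inequality hold trivially at \<open>k = 0\<close>.\<close>

definition A_set ::
  "'w measure \<Rightarrow> (nat \<Rightarrow> nat \<Rightarrow> 'w \<Rightarrow> bool) \<Rightarrow> nat \<Rightarrow> real \<Rightarrow> int set" where
  "A_set M A n \<gamma> = {k. k \<ge> 1 \<and> avg_degree_prob M A n k \<ge> M_pow n \<gamma> * real_of_int k powr (- \<gamma>)}"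

definition B_set ::
  "'w measure \<Rightarrow> (nat \<Rightarrow> nat \<Rightarrow> 'w \<Rightarrow> bool) \<Rightarrow> nat \<Rightarrow> real \<Rightarrow> real \<Rightarrow> int set" where
  "B_set M A n \<gamma> \<mu> = {k. k \<ge> 1 \<and> avg_degree_prob M A n k \<ge>
     M_powexp n \<gamma> \<mu> * real_of_int k powr (- \<gamma>) * exp (- \<mu> * real_of_int k)}"

end

theory Submission
  imports Defs "HOL-Real_Asymp.Real_Asymp"
begin

text \<open>
  Both normalising constants are bounded uniformly in \<open>n\<close> (\<open>M_pow_le_1\<close>, \<open>M_powexp_le_exp\<close>), so
  everything follows from one lower bound for the average degree distribution: for large \<open>n\<close> and
  \<open>1 \<le> k \<le> n / 4\<close> it is at least
  \<open>\<delta> * min k (n^c) * n^(- 2 * c) * exp (- 2 * lambda1 * k * n^(- c))\<close>.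

  The edges of node \<open>i\<close> to larger nodes (its row) are consecutive in the order \<open>\<omega>\<^sub>1\<close>, and its edges
  to smaller nodes (its column) all come earlier. Suppose that at time \<open>m\<close>, just before the row,
  the column has produced \<open>t < k\<close> ones and the chain is in state 0. Then the degree is \<open>k\<close> as soon
  as the ones of the row form a single run of length \<open>k - t\<close>. For a fixed position of the run this
  has probability of order \<open>p0 * (1 - p1) * p1^(k - t)\<close> if the run does not touch the end of the
  row: the run has to be opened and closed once, and staying in 0 for the rest of the row costs only
  a constant factor because \<open>p0\<close> is \<open>lambda0 / n\<close>. Different positions give disjoint events,
  and their number, of order \<open>n\<close>, compensates the factor \<open>p0\<close>; what is left is of order at least
  \<open>n^(- c) * p1^k\<close> (\<open>prob_block_count_ge\<close>).

  For large \<open>n\<close> the condition on the past holds with probability at least 1/2 if the expected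
  column sum is at most \<open>k / 4\<close>. This follows from the one-dimensional marginals of the chain by Markov's
  inequality (\<open>prob_sample_count_ge\<close>). The density of ones is of order \<open>n^(c - 1)\<close>, so for \<open>k \<le> n^c\<close> the
  first \<open>\<epsilon> * k * n^(1 - c)\<close> nodes can be used, and these are a fraction \<open>\<epsilon> * k * n^(- c)\<close>
  of all nodes. This linear gain in \<open>k\<close> is what brings the lower end of the power law range
  down to \<open>n^(2 * c / (1 + \<gamma>))\<close>: there the inequality to be proved is
  \<open>k^(- \<gamma>) \<le> const * k * n^(- 2 * c)\<close>. For \<open>k > n^c\<close> a constant fraction of the
  nodes is used. There \<open>k^(- \<gamma>)\<close> is at most \<open>n^(- \<gamma> * c)\<close>, much smaller than \<open>n^(- c)\<close>, and this
  leaves room for the exponential factor to fall to a small negative power of \<open>n\<close>, that is, for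
  \<open>k\<close> up to a small multiple of \<open>n^c * ln n\<close>.
  With the exponential cutoff the target \<open>exp (- \<mu> * k)\<close> decays faster than
  \<open>exp (- 2 * lambda1 * k * n^(- c))\<close>, since \<open>n^(- c)\<close> tends to 0, and from \<open>k\<close> of order \<open>ln n\<close> on the
  difference also beats the factor \<open>n^(- 2 * c)\<close>.
\<close>

section \<open>Path probabilities of the chain\<close>

definition step_prob :: "real \<Rightarrow> real \<Rightarrow> bool \<Rightarrow> bool \<Rightarrow> real" where
  "step_prob p0 p1 x y = (let a = if x then p1 else p0 in if y then a else 1 - a)"

locale binary_chain = prob_space M
  for M :: "'w measure" and B :: "nat \<Rightarrow> 'w \<Rightarrow> bool" and N :: nat and p0 p1 :: real +
  assumes chain: "stationary_binary_chain M B N p0 p1"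
begin

text \<open>The past is encoded by the set of times at which the chain is in state 1, so that it has
  finitely many values and an event about the past is a predicate on finite sets.\<close>

definition history :: "nat \<Rightarrow> 'w \<Rightarrow> nat set" where
  "history m w = {l\<in>{1..m}. B l w}"

lemma history_Int: "m \<le> m' \<Longrightarrow> history m' w \<inter> {1..m} = history m w"
  by (auto simp: history_def)

lemma history_eq_iff:
  "h \<subseteq> {1..m} \<Longrightarrow> history m w = h \<longleftrightarrow> (\<forall>l\<in>{1..m}. B l w = (l \<in> h))"
  by (auto simp: history_def)

lemma B_events: "l \<in> {1..N} \<Longrightarrow> {w\<in>space M. B l w} \<in> events"
  using chain unfolding stationary_binary_chain_def pred_def[symmetric] by blast

lemma history_single_events:
  assumes "m \<le> N" "h \<subseteq> {1..m}"
  shows "{w\<in>space M. history m w = h} \<in> events"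
proof -
  have "{w\<in>space M. \<forall>l\<in>{1..m}. B l w = (l \<in> h)} \<in> events"
  proof (rule sets.sets_Collect_finite_All)
    fix l assume "l \<in> {1..m}"
    then have l: "{w\<in>space M. B l w} \<in> events" using assms(1) by (intro B_events) auto
    show "{w\<in>space M. B l w = (l \<in> h)} \<in> events"
      using l sets.sets_Collect_neg[OF l] by (cases "l \<in> h") auto
  qed auto
  then show ?thesis using history_eq_iff[OF assms(2)] by simp
qed

lemma history_events:
  assumes "m \<le> N"
  shows "{w\<in>space M. Q (history m w)} \<in> events"
proof -
  have "{w\<in>space M. Q (history m w)} = (\<Union>h\<in>{h\<in>Pow {1..m}. Q h}. {w\<in>space M. history m w = h})"
    by (auto simp: history_def)
  also have "\<dots> \<in> events"
    using history_single_events[OF assms] by (intro sets.finite_UN) auto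
  finally show ?thesis .
qed

lemma prob_history_sum:
  assumes "m \<le> N" "m' \<le> N"
  shows "prob {w\<in>space M. Q (history m w) \<and> R (history m' w)} =
    (\<Sum>h\<in>{h\<in>Pow {1..m}. Q h}. prob {w\<in>space M. history m w = h \<and> R (history m' w)})"
proof -
  have "{w\<in>space M. Q (history m w) \<and> R (history m' w)} =
      (\<Union>h\<in>{h\<in>Pow {1..m}. Q h}. {w\<in>space M. history m w = h \<and> R (history m' w)})"
    by (auto simp: history_def)
  moreover have "{w\<in>space M. history m w = h \<and> R (history m' w)} \<in> events" for h
  proof -
    have "{w\<in>space M. history m w = h \<and> R (history m' w)} =
        {w\<in>space M. history m w = h} \<inter> {w\<in>space M. R (history m' w)}" by auto
    then show ?thesis
      using history_events[OF assms(1), of "\<lambda>x. x = h"] history_events[OF assms(2), of R] by auto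
  qed
  ultimately show ?thesis
    by (simp, intro finite_measure_finite_Union) (auto simp: disjoint_family_on_def)
qed

text \<open>The transition probabilities are only prescribed after histories of positive probability;
  after a null history both sides vanish.\<close>

lemma prob_history_step:
  assumes m: "m \<in> {1..<N}" and h: "h \<subseteq> {1..m}"
  shows "prob {w\<in>space M. history m w = h \<and> B (Suc m) w = y} =
    prob {w\<in>space M. history m w = h} * step_prob p0 p1 (m \<in> h) y"
proof -
  let ?H = "{w\<in>space M. history m w = h}"
  let ?J = "\<lambda>y. {w\<in>space M. history m w = h \<and> B (Suc m) w = y}"
  have H: "?H \<in> events" using history_single_events[of m h] m h by auto
  have B1: "{w\<in>space M. B (Suc m) w} \<in> events" using m by (intro B_events) auto
  have J: "?J y \<in> events" for y
  proof -
    have "?J True = ?H \<inter> {w\<in>space M. B (Suc m) w}" "?J False = ?H - {w\<in>space M. B (Suc m) w}"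
      by auto
    then show ?thesis using sets.Int[OF H B1] sets.Diff[OF H B1] by (cases y) simp_all
  qed
  have tot: "prob ?H = prob (?J True) + prob (?J False)"
  proof -
    have "?H = ?J True \<union> ?J False" by auto
    then show ?thesis using finite_measure_Union[OF J[of True] J[of False]] by auto
  qed
  have main: "prob (?J True) = prob ?H * (if m \<in> h then p1 else p0)"
  proof (cases "prob ?H > 0")
    case False
    then have "prob ?H = 0" by (metis measure_nonneg less_eq_real_def)
    moreover have "prob (?J True) \<le> prob ?H" by (rule finite_measure_mono[OF _ H]) auto
    ultimately show ?thesis by (metis measure_nonneg mult_zero_left order_antisym)
  next
    case True
    have hist: "\<P>(w in M. \<forall>l\<in>{1..m}. B l w = (l \<in> h)) = prob ?H"
      using history_eq_iff[OF h] by simp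
    have "\<P>(w in M. B (Suc m) w \<bar> \<forall>l\<in>{1..m}. B l w = (l \<in> h)) =
        \<P>(w in M. B (Suc m) w \<bar> B m w = (m \<in> h))"
      using chain m True hist unfolding stationary_binary_chain_def by auto
    also have "\<dots> = (if m \<in> h then p1 else p0)"
    proof -
      have Bm: "{w\<in>space M. B m w} \<in> events" using m by (intro B_events) auto
      have "{w\<in>space M. B m w = (m \<in> h)} \<in> events"
        using Bm sets.sets_Collect_neg[OF Bm] by (cases "m \<in> h") auto
      then have "prob ?H \<le> prob {w\<in>space M. B m w = (m \<in> h)}"
        using history_eq_iff[OF h] m by (intro finite_measure_mono) auto
      then have "prob {w\<in>space M. B m w = (m \<in> h)} > 0" using True by linarith
      then show ?thesis
        using chain m unfolding stationary_binary_chain_def by (cases "m \<in> h") auto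
    qed
    finally have "prob (?J True) / prob ?H = (if m \<in> h then p1 else p0)"
      using hist history_eq_iff[OF h, symmetric] by (simp add: cond_prob_def conj_commute)
    then show ?thesis using True by (simp add: field_simps)
  qed
  show ?thesis using tot main by (cases y) (auto simp: step_prob_def Let_def algebra_simps)
qed

text \<open>The Markov property for arbitrary events of the past, as long as they fix the current state.\<close>

lemma prob_step:
  assumes m: "m \<in> {1..<N}" and Q: "\<And>h. Q h \<Longrightarrow> (m \<in> h) = x"
  shows "prob {w\<in>space M. Q (history m w) \<and> B (Suc m) w = y} =
    prob {w\<in>space M. Q (history m w)} * step_prob p0 p1 x y"
proof -
  have B1: "B (Suc m) w = (Suc m \<in> history (Suc m) w)" for w by (auto simp: history_def)
  have "prob {w\<in>space M. Q (history m w) \<and> B (Suc m) w = y} =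
      (\<Sum>h\<in>{h\<in>Pow {1..m}. Q h}. prob {w\<in>space M. history m w = h \<and> B (Suc m) w = y})"
    using prob_history_sum[of m "Suc m" Q "\<lambda>h. (Suc m \<in> h) = y"] m by (simp add: B1)
  also have "\<dots> = (\<Sum>h\<in>{h\<in>Pow {1..m}. Q h}. prob {w\<in>space M. history m w = h} * step_prob p0 p1 x y)"
    using prob_history_step[OF m] Q by (intro sum.cong) auto
  also have "\<dots> = prob {w\<in>space M. Q (history m w)} * step_prob p0 p1 x y"
    using prob_history_sum[of m m Q "\<lambda>_. True"] m by (simp add: sum_distrib_right)
  finally show ?thesis .
qed

lemma prob_path:
  assumes "1 \<le> m" "m + len \<le> N"
  shows "prob {w\<in>space M. Q (history m w) \<and> (\<forall>l\<in>{m..m+len}. B l w = b l)} =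
    prob {w\<in>space M. Q (history m w) \<and> B m w = b m} *
    (\<Prod>l\<in>{m..<m+len}. step_prob p0 p1 (b l) (b (Suc l)))"
  using assms(2)
proof (induction len)
  case 0
  then show ?case by simp
next
  case (Suc len)
  \<comment> \<open>The event \<open>Q\<close> together with the first \<open>len\<close> steps of the path, as an event of the past of
    time \<open>m + len\<close>.\<close>
  let ?Q = "\<lambda>h. Q (h \<inter> {1..m}) \<and> (\<forall>l\<in>{m..m+len}. (l \<in> h) = b l)"
  have Q: "?Q (history (m+len) w) \<longleftrightarrow> Q (history m w) \<and> (\<forall>l\<in>{m..m+len}. B l w = b l)" for w
    using assms(1) history_Int[of m "m+len" w] by (auto simp: history_def)
  have set: "{m..m + Suc len} = insert (Suc (m+len)) {m..m+len}" by auto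
  have "prob {w\<in>space M. Q (history m w) \<and> (\<forall>l\<in>{m..m+Suc len}. B l w = b l)} =
      prob {w\<in>space M. ?Q (history (m+len) w) \<and> B (Suc (m+len)) w = b (Suc (m+len))}"
    unfolding Q set by (simp add: conj_ac)
  also have "\<dots> = prob {w\<in>space M. ?Q (history (m+len) w)} *
      step_prob p0 p1 (b (m+len)) (b (Suc (m+len)))"
    using Suc.prems assms(1) by (intro prob_step) auto
  also have "\<dots> = prob {w\<in>space M. Q (history m w) \<and> B m w = b m} *
      (\<Prod>l\<in>{m..<m+Suc len}. step_prob p0 p1 (b l) (b (Suc l)))"
    using Suc unfolding Q by (simp add: mult_ac)
  finally show ?case .
qed

section \<open>Blocks with a single run of ones\<close>

text \<open>The run is opened by one step of probability \<open>p0\<close> and, because it ends before \<open>t\<close>, closed by one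
  step of probability \<open>1 - p1\<close>. The power of \<open>1 - p0\<close> does not depend on the position of the
  run, so that all positions can be summed up.\<close>

lemma prod_step_prob_run:
  assumes "m \<le> u" "1 \<le> r" "u + r < t" and b: "b = (\<lambda>l. u < l \<and> l \<le> u + r)"
  shows "(\<Prod>l\<in>{m..<t}. step_prob p0 p1 (b l) (b (Suc l))) =
    p0 * p1 ^ (r - 1) * (1 - p1) * (1 - p0) ^ (t - m - r - 1)"
proof -
  let ?f = "\<lambda>l. step_prob p0 p1 (b l) (b (Suc l))"
  have "prod ?f {m..<t} = prod ?f {m..<u} * (prod ?f {u..<Suc u} *
      (prod ?f {Suc u..<u+r} * (prod ?f {u+r..<Suc (u+r)} * prod ?f {Suc (u+r)..<t})))"
    using assms(1-3) prod.atLeastLessThan_concat[of m u t ?f] prod.atLeastLessThan_concat[of u "Suc u" t ?f]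
      prod.atLeastLessThan_concat[of "Suc u" "u+r" t ?f]
      prod.atLeastLessThan_concat[of "u+r" "Suc (u+r)" t ?f] by simp
  also have "prod ?f {m..<u} = (\<Prod>l\<in>{m..<u}. 1 - p0)"
    by (intro prod.cong) (auto simp: b step_prob_def)
  also have "prod ?f {u..<Suc u} = p0" using assms(2) by (simp add: b step_prob_def)
  also have "prod ?f {Suc u..<u+r} = (\<Prod>l\<in>{Suc u..<u+r}. p1)"
    by (intro prod.cong) (auto simp: b step_prob_def)
  also have "prod ?f {u+r..<Suc (u+r)} = 1 - p1" using assms(2) by (simp add: b step_prob_def)
  also have "prod ?f {Suc (u+r)..<t} = (\<Prod>l\<in>{Suc (u+r)..<t}. 1 - p0)"
    by (intro prod.cong) (auto simp: b step_prob_def)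
  finally have "prod ?f {m..<t} =
      p0 * p1 ^ (r - 1) * (1 - p1) * ((1 - p0) ^ (u - m) * (1 - p0) ^ (t - Suc (u + r)))"
    by (simp add: mult_ac)
  also have "(1 - p0) ^ (u - m) * (1 - p0) ^ (t - Suc (u + r)) = (1 - p0) ^ (t - m - r - 1)"
    using assms(1-3) by (simp flip: power_add)
  finally show ?thesis .
qed

text \<open>Among the ways to place \<open>r\<close> ones in a block, only single runs are counted that start within the
  block and end before its last position. There are \<open>L - r\<close> of them, they are disjoint and they have the
  same probability. Being in state 0 before the block makes the first one of the run a transition
  from 0 to 1 also if it is the first variable of the block.\<close>

lemma prob_block_count_ge:
  assumes m: "1 \<le> m" "m + L \<le> N" and r: "1 \<le> r" "r \<le> L"
  shows "prob {w\<in>space M. Q (history m w) \<and> card {l\<in>{m+1..m+L}. B l w} = r} \<ge>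
    prob {w\<in>space M. Q (history m w) \<and> \<not> B m w} *
    (real (L - r) * (p0 * p1 ^ (r - 1) * (1 - p1) * (1 - p0) ^ (L - r - 1)))"
proof -
  \<comment> \<open>\<open>u\<close> is the last time before the run.\<close>
  define b where "b u = (\<lambda>l. u < l \<and> l \<le> u + r)" for u :: nat
  let ?U = "{m..<m+L-r}"
  let ?E = "\<lambda>u. {w\<in>space M. Q (history m w) \<and> (\<forall>l\<in>{m..m+L}. B l w = b u l)}"
  let ?F = "{w\<in>space M. Q (history m w) \<and> card {l\<in>{m+1..m+L}. B l w} = r}"
  let ?c = "p0 * p1 ^ (r - 1) * (1 - p1) * (1 - p0) ^ (L - r - 1)"
  have Q: "Q (history m w) = Q (history (m+L) w \<inter> {1..m})" for w
    using history_Int[of m "m+L"] by simp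
  have B: "B l w = (l \<in> history (m+L) w)" if "l \<in> {m..m+L}" for l w
    using that m by (auto simp: history_def)
  have "{l\<in>{m+1..m+L}. B l w} = {l\<in>{m+1..m+L}. l \<in> history (m+L) w}" for w
    using B by auto
  then have F: "?F \<in> events"
    using history_events[OF m(2), of "\<lambda>h. Q (h \<inter> {1..m}) \<and> card {l\<in>{m+1..m+L}. l \<in> h} = r"]
    by (simp add: Q)
  have E: "?E u \<in> events" for u
    using history_events[OF m(2), of "\<lambda>h. Q (h \<inter> {1..m}) \<and> (\<forall>l\<in>{m..m+L}. (l \<in> h) = b u l)"] B
    by (simp add: Q)
  have sub: "?E u \<subseteq> ?F" if u: "u \<in> ?U" for u
  proof -
    have "card {l\<in>{m+1..m+L}. B l w} = r" if "\<forall>l\<in>{m..m+L}. B l w = b u l" for w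
    proof -
      have "{l\<in>{m+1..m+L}. B l w} = {u<..u+r}" using that u r by (auto simp: b_def)
      then show ?thesis by simp
    qed
    then show ?thesis by auto
  qed
  have disj: "disjoint_family_on ?E ?U"
  proof (unfold disjoint_family_on_def, intro ballI impI)
    have b_less: "\<exists>l\<in>{m..m+L}. b u l \<noteq> b v l" if "u < v" "u \<in> ?U" "v \<in> ?U" for u v
      using that r by (intro bexI[of _ "Suc u"]) (auto simp: b_def)
    fix u v assume "u \<in> ?U" "v \<in> ?U" "u \<noteq> v"
    then have "\<exists>l\<in>{m..m+L}. b u l \<noteq> b v l" using b_less[of u v] b_less[of v u] by (metis nat_neq_iff)
    then show "?E u \<inter> ?E v = {}" by auto
  qed
  have pE: "prob (?E u) = prob {w\<in>space M. Q (history m w) \<and> \<not> B m w} * ?c" if u: "u \<in> ?U" for u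
  proof -
    have "\<not> b u m" using u by (auto simp: b_def)
    then have "prob (?E u) = prob {w\<in>space M. Q (history m w) \<and> \<not> B m w} *
        (\<Prod>l\<in>{m..<m+L}. step_prob p0 p1 (b u l) (b u (Suc l)))"
      using prob_path[OF m, of Q "b u"] by simp
    moreover have "m \<le> u" "u + r < m + L" using u r by auto
    ultimately show ?thesis
      using prod_step_prob_run[of m u r "m+L" "b u", OF _ r(1) _ b_def] by simp
  qed
  have "prob {w\<in>space M. Q (history m w) \<and> \<not> B m w} * (real (L - r) * ?c) = (\<Sum>u\<in>?U. prob (?E u))"
    using pE r by simp
  also have "\<dots> = prob (\<Union>u\<in>?U. ?E u)"
    using E disj by (intro finite_measure_finite_Union[symmetric]) auto
  also have "\<dots> \<le> prob ?F" using sub by (intro finite_measure_mono F UN_least)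
  finally show ?thesis .
qed

lemma prob_B: "l \<in> {1..N} \<Longrightarrow> prob {w\<in>space M. B l w} = p0 / (1 + p0 - p1)"
  using chain unfolding stationary_binary_chain_def by blast

text \<open>Markov's inequality for the count, whose mean is determined by the marginal law.\<close>

lemma prob_sample_count_ge:
  assumes J: "finite J" "f ` J \<subseteq> {1..N}" and "k \<ge> 1"
  shows "prob {w\<in>space M. card {j\<in>J. B (f j) w} \<ge> k} \<le> real (card J) * (p0 / (1 + p0 - p1)) / real k"
proof -
  let ?X = "\<lambda>w. \<Sum>j\<in>J. indicator {w\<in>space M. B (f j) w} w :: real"
  have ev: "{w\<in>space M. B (f j) w} \<in> events" if "j \<in> J" for j
    using that J by (intro B_events) auto
  have X: "?X w = real (card {j\<in>J. B (f j) w})" if "w \<in> space M" for w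
    using that J(1) by (simp add: indicator_def sum.If_cases Int_def)
  have int1: "integrable M (indicator {w\<in>space M. B (f j) w} :: _ \<Rightarrow> real)" if "j \<in> J" for j
    using ev[OF that] by (intro integrable_real_indicator) (auto simp: less_top[symmetric])
  then have int: "integrable M ?X" by (rule Bochner_Integration.integrable_sum)
  have "expectation ?X = (\<Sum>j\<in>J. prob {w\<in>space M. B (f j) w})"
    using int1 ev by (subst Bochner_Integration.integral_sum)
      (auto simp: Int_absorb2 sets.sets_into_space intro!: sum.cong)
  also have "\<dots> = real (card J) * (p0 / (1 + p0 - p1))"
    using J by (subst sum.cong[OF refl prob_B]) auto
  finally have ex: "expectation ?X = real (card J) * (p0 / (1 + p0 - p1))" .
  have "prob {w\<in>space M. ?X w \<ge> real k} \<le> expectation ?X / real k"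
    using assms(3) int by (intro integral_Markov_inequality_measure[where A="space M"])
      (auto simp: sum_nonneg)
  moreover have "{w\<in>space M. ?X w \<ge> real k} = {w\<in>space M. card {j\<in>J. B (f j) w} \<ge> k}"
    using X by auto
  ultimately show ?thesis using ex by simp
qed

text \<open>Whatever the number \<open>t < k\<close> of ones in an earlier sample of the chain is, the block can
  supply the missing \<open>k - t\<close> ones by a single run. The first factor bounds from below the
  probability that the sample has fewer than \<open>k\<close> ones and the chain is in state 0 before the
  block: Markov's inequality and a union bound give it whatever the dependence between the
  two. In the second factor \<open>k\<close> replaces the length \<open>k - t\<close> of the run, which makes it independent
  of \<open>t\<close>.\<close>

lemma prob_sample_plus_block_ge:
  assumes m: "1 \<le> m" "m + L \<le> N" and k: "1 \<le> k" "k \<le> L"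
    and J: "finite J" "f ` J \<subseteq> {1..m}"
    and p: "0 \<le> p0" "p0 \<le> 1" "0 \<le> p1" "p1 \<le> 1"
  shows "prob {w\<in>space M. card {j\<in>J. B (f j) w} + card {l\<in>{m+1..m+L}. B l w} = k} \<ge>
    (1 - real (card J) * (p0 / (1 + p0 - p1)) / real k - p0 / (1 + p0 - p1)) *
    (real (L - k) * (p0 * p1 ^ k * (1 - p1) * (1 - p0) ^ L))"
proof -
  let ?C = "\<lambda>w. card {j\<in>J. B (f j) w}" and ?R = "\<lambda>w. card {l\<in>{m+1..m+L}. B l w}"
  let ?Q = "\<lambda>t h. card {j\<in>J. f j \<in> h} = t"
  let ?c = "real (L - k) * (p0 * p1 ^ k * (1 - p1) * (1 - p0) ^ L)"
  have C: "?C w = card {j\<in>J. f j \<in> history m w}" "?C w = card {j\<in>J. f j \<in> history (m+L) w}" for w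
    using J by (auto simp: history_def intro!: arg_cong[of _ _ card])
  have R: "?R w = card {l\<in>{m+1..m+L}. l \<in> history (m+L) w}" for w
    by (auto simp: history_def intro!: arg_cong[of _ _ card])
  have ev: "{w\<in>space M. P (?C w) (?R w)} \<in> events" for P
    using history_events[OF m(2), of "\<lambda>h. P (card {j\<in>J. f j \<in> h}) (card {l\<in>{m+1..m+L}. l \<in> h})"]
    by (simp only: C(2) R)
  have Bm: "B m w = (m \<in> history m w)" for w using m by (auto simp: history_def)
  have evC: "{w\<in>space M. P (?C w) (B m w)} \<in> events" for P
    using history_events[of m "\<lambda>h. P (card {j\<in>J. f j \<in> h}) (m \<in> h)"] m
    by (simp add: C(1) Bm)
  let ?G = "\<lambda>t. {w\<in>space M. ?C w = t \<and> \<not> B m w}"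
  have c_le: "?c \<le> real (L - r) * (p0 * p1 ^ (r - 1) * (1 - p1) * (1 - p0) ^ (L - r - 1))"
    if "r \<le> k" for r
    using that p by (intro mult_mono power_decreasing mult_nonneg_nonneg) auto
  have c0: "?c \<ge> 0" using p by auto
  have each: "prob (?G t) * ?c \<le> prob {w\<in>space M. ?C w = t \<and> ?R w = k - t}" if t: "t < k" for t
  proof -
    have "prob (?G t) * ?c \<le> prob (?G t) *
        (real (L - (k - t)) * (p0 * p1 ^ (k - t - 1) * (1 - p1) * (1 - p0) ^ (L - (k - t) - 1)))"
      using c_le[of "k - t"] by (intro mult_left_mono) auto
    also have "\<dots> \<le> prob {w\<in>space M. ?C w = t \<and> ?R w = k - t}"
      using prob_block_count_ge[OF m, of "k - t" "?Q t"] t k unfolding C(1)[symmetric] by simp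
    finally show ?thesis .
  qed
  have "1 \<le> prob ({w\<in>space M. ?C w < k \<and> \<not> B m w} \<union>
      ({w\<in>space M. ?C w \<ge> k} \<union> {w\<in>space M. B m w}))"
  proof -
    have "{w\<in>space M. ?C w < k \<and> \<not> B m w} \<union> ({w\<in>space M. ?C w \<ge> k} \<union> {w\<in>space M. B m w}) = space M"
      by auto
    then show ?thesis using prob_space by simp
  qed
  also have "\<dots> \<le> prob {w\<in>space M. ?C w < k \<and> \<not> B m w} +
      (prob {w\<in>space M. ?C w \<ge> k} + prob {w\<in>space M. B m w})"
    using evC[of "\<lambda>x y. x < k \<and> \<not> y"] evC[of "\<lambda>x y. x \<ge> k"] evC[of "\<lambda>x y. y"]
    by (intro order_trans[OF measure_Un_le] add_left_mono measure_Un_le) auto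
  also have "prob {w\<in>space M. ?C w < k \<and> \<not> B m w} = (\<Sum>t<k. prob (?G t))"
  proof -
    have "{w\<in>space M. ?C w < k \<and> \<not> B m w} = (\<Union>t\<in>{..<k}. ?G t)" by auto
    then show ?thesis using evC[of "\<lambda>x y. x = t \<and> \<not> y" for t]
      by (simp, intro finite_measure_finite_Union) (auto simp: disjoint_family_on_def)
  qed
  finally have total: "1 \<le> (\<Sum>t<k. prob (?G t)) +
      (prob {w\<in>space M. ?C w \<ge> k} + prob {w\<in>space M. B m w})" .
  have "f ` J \<subseteq> {1..N}" "m \<in> {1..N}" using J(2) m by auto
  then have "1 - real (card J) * (p0 / (1 + p0 - p1)) / real k - p0 / (1 + p0 - p1) \<le>
      (\<Sum>t<k. prob (?G t))"
    using prob_sample_count_ge[OF J(1), of f k] prob_B[of m] k(1) total by linarith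
  from mult_right_mono[OF this c0]
  have "(1 - real (card J) * (p0 / (1 + p0 - p1)) / real k - p0 / (1 + p0 - p1)) * ?c \<le>
      (\<Sum>t<k. prob (?G t) * ?c)" by (simp add: sum_distrib_right)
  also have "\<dots> \<le> (\<Sum>t<k. prob {w\<in>space M. ?C w = t \<and> ?R w = k - t})"
    using each by (intro sum_mono) auto
  also have "\<dots> = prob (\<Union>t\<in>{..<k}. {w\<in>space M. ?C w = t \<and> ?R w = k - t})"
    using ev[of "\<lambda>x y. x = t \<and> y = k - t" for t]
    by (intro finite_measure_finite_Union[symmetric]) (auto simp: disjoint_family_on_def)
  also have "\<dots> \<le> prob {w\<in>space M. ?C w + ?R w = k}"
  proof (rule finite_measure_mono)
    show "{w\<in>space M. ?C w + ?R w = k} \<in> events" by (rule ev)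
  qed (simp add: UN_subset_iff subset_iff)
  finally show ?thesis .
qed

end

section \<open>Degrees under the row order\<close>

text \<open>The edges from \<open>i\<close> to larger nodes occupy the \<open>n - i\<close> positions after \<open>row_offset n i\<close>.\<close>

definition row_offset :: "nat \<Rightarrow> nat \<Rightarrow> nat" where
  "row_offset n i = n * (i - 1) - i * (i - 1) div 2"

lemma omega1_pair: "i < j \<Longrightarrow> omega1 n {i, j} = row_offset n i + j - i"
  by (simp add: omega1_def row_offset_def Let_def)

lemma row_offset_Suc:
  assumes "1 \<le> i" "i \<le> n"
  shows "row_offset n (Suc i) = row_offset n i + (n - i)"
proof -
  obtain a where a: "i = Suc a" using assms(1) by (cases i) auto
  have tri: "Suc (Suc a) * Suc a div 2 = Suc a * a div 2 + Suc a"
  proof -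
    have "Suc (Suc a) * Suc a = Suc a * a + Suc a * 2" by (simp add: algebra_simps)
    then show ?thesis by simp
  qed
  have "Suc a * a div 2 \<le> Suc a * a" by simp
  also have "\<dots> \<le> n * a" using assms(2) a by (intro mult_right_mono) auto
  finally have "Suc a * a div 2 \<le> n * a" .
  moreover have "row_offset n (Suc i) = n * a + n - (Suc a * a div 2 + Suc a)"
    unfolding row_offset_def a tri by (simp add: add.commute)
  moreover have "row_offset n i = n * a - Suc a * a div 2" by (simp add: row_offset_def a)
  ultimately show ?thesis using assms(2) a by linarith
qed

lemma row_offset_gap:
  assumes "1 \<le> j" "j < i" "i \<le> n"
  shows "row_offset n j + (n - j) \<le> row_offset n i"
  using assms(2,3)
proof (induction i)
  case (Suc i)
  have "row_offset n j + (n - j) = row_offset n (Suc i)" if "i = j"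
    using that Suc.prems assms(1) by (simp add: row_offset_Suc)
  moreover have "row_offset n j + (n - j) \<le> row_offset n (Suc i)" if "i \<noteq> j"
    using that Suc assms(1) row_offset_Suc[of i n] by simp
  ultimately show ?case by (cases "i = j") auto
qed simp

lemma node_degree_row_split:
  assumes i: "1 \<le> i" "i \<le> n"
    and irr: "\<not> A i i w"
    and B: "\<And>j. j \<in> {1..n} \<Longrightarrow> i \<noteq> j \<Longrightarrow> B (omega1 n {i, j}) w = A i j w"
  shows "node_degree A n i w = card {j\<in>{1..<i}. B (omega1 n {j, i}) w} +
    card {l\<in>{row_offset n i + 1..row_offset n i + (n - i)}. B l w}"
proof -
  let ?m = "row_offset n i"
  have "{j\<in>{1..n}. A i j w} = {j\<in>{1..<i}. B (omega1 n {j, i}) w} \<union> {j\<in>{i+1..n}. A i j w}"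
  proof (intro set_eqI)
    fix j
    show "j \<in> {j\<in>{1..n}. A i j w} \<longleftrightarrow>
        j \<in> {j\<in>{1..<i}. B (omega1 n {j, i}) w} \<union> {j\<in>{i+1..n}. A i j w}"
      by (cases i j rule: linorder_cases)
        (use i irr B[of j] in \<open>auto simp: insert_commute[of j i "{}"]\<close>)
  qed
  then have "node_degree A n i w =
      card ({j\<in>{1..<i}. B (omega1 n {j, i}) w} \<union> {j\<in>{i+1..n}. A i j w})"
    unfolding node_degree_def by (rule arg_cong)
  also have "\<dots> = card {j\<in>{1..<i}. B (omega1 n {j, i}) w} + card {j\<in>{i+1..n}. A i j w}"
    by (rule card_Un_disjoint) auto
  also have "card {j\<in>{i+1..n}. A i j w} = card {l\<in>{?m+1..?m+(n-i)}. B l w}"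
  proof (rule bij_betw_same_card)
    have row: "A i j w = B (?m + j - i) w" if "j \<in> {i+1..n}" for j
      using that i B[of j] by (simp add: omega1_pair)
    have l: "l + i - ?m \<in> {i+1..n}" "?m + (l + i - ?m) - i = l" if "l \<in> {?m+1..?m+(n-i)}" for l
      using that i by auto
    show "bij_betw (\<lambda>j. ?m + j - i) {j\<in>{i+1..n}. A i j w} {l\<in>{?m+1..?m+(n-i)}. B l w}"
    proof (rule bij_betw_byWitness[where f' = "\<lambda>l. l + i - ?m"])
      show "(\<lambda>l. l + i - ?m) ` {l\<in>{?m+1..?m+(n-i)}. B l w} \<subseteq> {j\<in>{i+1..n}. A i j w}"
        using l row by auto
    qed (use row in auto)
  qed
  finally show ?thesis .
qed

text \<open>The row of \<open>i\<close> is the block and its column the sample. For \<open>i = 1\<close> there would be no edge variable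
  before the row.\<close>

lemma degree_prob_ge:
  assumes G: "MECLTG M A n (omega1 n) p0 p1"
    and i: "2 \<le> i" and k: "1 \<le> k" "k + i \<le> n"
    and p: "0 \<le> p0" "p0 \<le> 1" "0 \<le> p1" "p1 \<le> 1"
  shows "(1 - real (i - 1) * (p0 / (1 + p0 - p1)) / real k - p0 / (1 + p0 - p1)) *
      (real (n - i - k) * (p0 * p1 ^ k * (1 - p1) * (1 - p0) ^ (n - i)))
    \<le> \<P>(w in M. int (node_degree A n i w) = int k)"
proof -
  let ?N = "n * (n - 1) div 2"
  note G' = G[unfolded MECLTG_def]
  have bij: "bij_betw (omega1 n) {e. e \<subseteq> {1..n} \<and> card e = 2} {1..?N}"
    and irr: "\<forall>w\<in>space M. \<forall>i\<in>{1..n}. \<not> A i i w"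
    using conjunct1[OF G'] conjunct1[OF conjunct2[OF G']] .
  obtain B where B: "stationary_binary_chain M B ?N p0 p1"
    and BA: "\<forall>w\<in>space M. \<forall>i\<in>{1..n}. \<forall>j\<in>{1..n}. i \<noteq> j \<longrightarrow> B (omega1 n {i, j}) w = A i j w"
    using conjunct2[OF conjunct2[OF G']] by (elim conjE exE)
  interpret binary_chain M B ?N p0 p1
  proof (intro binary_chain.intro binary_chain_axioms.intro)
    show "prob_space M" using B unfolding stationary_binary_chain_def by (rule conjunct1)
  qed (rule B)
  let ?m = "row_offset n i" and ?L = "n - i"
  have "{i, n} \<in> {e. e \<subseteq> {1..n} \<and> card e = 2}" using i k by auto
  then have "omega1 n {i, n} \<in> {1..?N}" using bij_betwE[OF bij] by blast
  then have mN: "?m + ?L \<le> ?N" using i k by (simp add: omega1_pair)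
  have m1: "1 \<le> ?m" using row_offset_gap[of 1 i n] i k by simp
  have J: "(\<lambda>j. omega1 n {j, i}) ` {1..<i} \<subseteq> {1..?m}"
  proof (intro image_subsetI)
    fix j assume "j \<in> {1..<i}"
    then have j: "1 \<le> j" "j < i" by auto
    then have "row_offset n j + (n - j) \<le> ?m" using k by (intro row_offset_gap) auto
    then show "omega1 n {j, i} \<in> {1..?m}"
      using j k unfolding omega1_pair[OF j(2)] atLeastAtMost_iff by arith
  qed
  have "node_degree A n i w = card {j\<in>{1..<i}. B (omega1 n {j, i}) w} +
      card {l\<in>{?m + 1..?m + ?L}. B l w}" if "w \<in> space M" for w
    using that i k irr BA by (intro node_degree_row_split) auto
  then have "{w\<in>space M. int (node_degree A n i w) = int k} =
      {w\<in>space M. card {j\<in>{1..<i}. B (omega1 n {j, i}) w} + card {l\<in>{?m + 1..?m + ?L}. B l w} = k}"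
    by auto
  then show ?thesis
    using prob_sample_plus_block_ge[OF m1 mN k(1) _ _ J p] k by simp
qed

section \<open>A lower bound for the average degree distribution\<close>

lemma one_minus_ge_exp:
  assumes "0 \<le> x" "x \<le> 1 / 2"
  shows "exp (- 2 * x) \<le> 1 - (x::real)"
proof -
  have "- x - 2 * x\<^sup>2 \<le> ln (1 - x)" using assms by (intro ln_one_minus_pos_lower_bound)
  moreover have "x\<^sup>2 \<le> x * (1 / 2)" unfolding power2_eq_square using assms by (intro mult_left_mono)
  ultimately have "exp (- 2 * x) \<le> exp (ln (1 - x))" by simp
  then show ?thesis using assms by simp
qed

lemma one_minus_power_ge_exp:
  assumes "0 \<le> x" "x \<le> 1 / 2"
  shows "exp (- 2 * x * real k) \<le> (1 - (x::real)) ^ k"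
  using power_mono[OF one_minus_ge_exp[OF assms], of k] by (simp add: mult_ac flip: exp_of_nat_mult)

text \<open>Only the nodes \<open>2, \<dots>, I\<close> are counted. For them the column sum has mean at most \<open>k / 4\<close>, and the
  single run has at least \<open>n / 2\<close> possible positions.\<close>

lemma avg_degree_prob_ge:
  fixes q lambda0 :: real
  assumes G: "MECLTG M A n (omega1 n) (lambda0 / real n) (1 - q)"
    and q: "0 < q" "q \<le> 1 / 2" and l0: "0 < lambda0" "2 * lambda0 \<le> real n"
    and k: "1 \<le> k" "4 * k \<le> n" and I: "4 * I \<le> n"
    and small: "real I * (lambda0 / real n / q) \<le> real k / 4" "lambda0 / real n / q \<le> 1 / 4"
  shows "(real I - 1) / real n * (lambda0 * q / 4 * exp (- 2 * lambda0) * exp (- 2 * q * real k))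
    \<le> avg_degree_prob M A n (int k)"
proof -
  let ?a = "lambda0 / real n" and ?p = "lambda0 / real n / (1 + lambda0 / real n - (1 - q))"
  let ?c = "lambda0 * q / 4 * exp (- 2 * lambda0) * exp (- 2 * q * real k)"
  let ?P = "\<lambda>i. \<P>(w in M. int (node_degree A n i w) = int k)"
  have n: "real n > 0" using l0 by linarith
  have p0: "0 < ?a" "?a \<le> 1 / 2" using l0 n by (auto simp: field_simps)
  have den: "q \<le> 1 + ?a - (1 - q)" using p0 by simp
  then have pos: "0 < 1 + ?a - (1 - q)" using q by linarith
  have p: "0 \<le> ?p" by (rule divide_nonneg_pos[OF less_imp_le[OF p0(1)] pos])
  have p_le: "?p \<le> ?a / q"
    by (rule divide_left_mono[OF den less_imp_le[OF p0(1)] mult_pos_pos[OF pos q(1)]])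
  have pow_p0: "exp (- 2 * lambda0) \<le> (1 - ?a) ^ m" if "m \<le> n" for m
  proof -
    have "exp (- 2 * lambda0) = exp (- 2 * ?a * real n)" using n by simp
    also have "\<dots> \<le> (1 - ?a) ^ n" using p0 by (intro one_minus_power_ge_exp) auto
    also have "\<dots> \<le> (1 - ?a) ^ m" using p0 by (intro power_decreasing that) linarith+
    finally show ?thesis .
  qed
  have deg: "?c \<le> ?P i" if i: "i \<in> {2..I}" for i
  proof -
    have "real (i - 1) * ?p \<le> real I * (?a / q)" using i p p_le by (intro mult_mono) auto
    from divide_right_mono[OF order_trans[OF this small(1)], of "real k"]
    have "real (i - 1) * ?p / real k \<le> 1 / 4" using k(1) by simp
    then have good: "1 / 2 \<le> 1 - real (i - 1) * ?p / real k - ?p" using p_le small(2) by linarith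
    have room: "real n / 2 \<le> real (n - i - k)" using i I k by (simp add: of_nat_diff)
    have "?c = 1 / 2 * (real n / 2 * (?a * exp (- 2 * q * real k) * q * exp (- 2 * lambda0)))"
      using n by simp
    also have "\<dots> \<le> (1 - real (i - 1) * ?p / real k - ?p) *
        (real (n - i - k) * (?a * (1 - q) ^ k * q * (1 - ?a) ^ (n - i)))"
    proof (rule mult_mono[OF good])
      show "real n / 2 * (?a * exp (- 2 * q * real k) * q * exp (- 2 * lambda0)) \<le>
          real (n - i - k) * (?a * (1 - q) ^ k * q * (1 - ?a) ^ (n - i))"
        using room p0 q pow_p0[of "n - i"] one_minus_power_ge_exp[of q k]
        by (intro mult_mono mult_nonneg_nonneg) auto
      show "0 \<le> 1 - real (i - 1) * ?p / real k - ?p" using good by linarith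
    qed (use p0 q l0 in auto)
    also have "\<dots> \<le> ?P i"
      using degree_prob_ge[OF G, of i k] i I k p0 q by simp
    finally show ?thesis .
  qed
  have "(real I - 1) * ?c \<le> real (card {2..I}) * ?c"
    using q l0 by (intro mult_right_mono) auto
  also have "\<dots> = (\<Sum>i\<in>{2..I}. ?c)" by simp
  also have "\<dots> \<le> (\<Sum>i\<in>{2..I}. ?P i)" using deg by (intro sum_mono)
  also have "\<dots> \<le> (\<Sum>i=1..n. ?P i)" using I by (intro sum_mono2) auto
  finally have "(real I - 1) * ?c \<le> (\<Sum>i=1..n. ?P i)" .
  from divide_right_mono[OF this less_imp_le[OF n]] show ?thesis
    unfolding avg_degree_prob_def by (simp only: times_divide_eq_left)
qed

text \<open>The number of nodes that are used is \<open>x = \<epsilon> * min k (n^c) * n^(1 - c)\<close>, rounded down: at most a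
  constant fraction of all nodes, and few enough to keep the mean column sum, which is at most
  \<open>(lambda0 / lambda1) * n^(c - 1)\<close> times this number, below \<open>k / 4\<close>.\<close>

lemma eventually_avg_degree_prob_ge:
  fixes lambda0 lambda1 c :: real
  assumes "lambda0 > 0" "lambda1 > 0" "0 < c" "c < 1"
  shows "\<exists>\<delta>>0. \<forall>\<^sub>F n :: nat in sequentially. \<forall>(M :: 'w measure) A k.
    MECLTG M A n (omega1 n) (lambda0 / real n) (1 - lambda1 * real n powr (- c)) \<longrightarrow>
    1 \<le> k \<longrightarrow> 4 * k \<le> n \<longrightarrow>
    \<delta> * min (real k) (real n powr c) * real n powr (- 2 * c) *
      exp (- 2 * lambda1 * real k * real n powr (- c)) \<le> avg_degree_prob M A n (int k)"
proof -
  define \<epsilon> where "\<epsilon> = min (1 / 4) (lambda1 / (4 * lambda0))"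
  have \<epsilon>: "0 < \<epsilon>" "\<epsilon> \<le> 1 / 4" "\<epsilon> * (lambda0 / lambda1) \<le> 1 / 4"
    using assms(1,2) by (auto simp: \<epsilon>_def min_def field_simps)
  define \<delta> where "\<delta> = \<epsilon> / 2 * (lambda0 * lambda1 / 4 * exp (- 2 * lambda0))"
  have "\<forall>\<^sub>F n :: nat in sequentially. lambda1 * real n powr (- c) \<le> 1 / 2"
    using assms by real_asymp
  moreover have "\<forall>\<^sub>F n :: nat in sequentially. lambda0 / lambda1 * real n powr (c - 1) \<le> 1 / 4"
    using assms by real_asymp
  moreover have "\<forall>\<^sub>F n :: nat in sequentially. 4 \<le> \<epsilon> * real n powr (1 - c)"
    using assms \<epsilon>(1) by real_asymp
  moreover have "\<forall>\<^sub>F n :: nat in sequentially. 2 * lambda0 \<le> real n" by real_asymp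
  moreover have "\<forall>\<^sub>F n :: nat in sequentially. 1 \<le> real n" by real_asymp
  ultimately have "\<forall>\<^sub>F n :: nat in sequentially. \<forall>(M :: 'w measure) A k.
    MECLTG M A n (omega1 n) (lambda0 / real n) (1 - lambda1 * real n powr (- c)) \<longrightarrow>
    1 \<le> k \<longrightarrow> 4 * k \<le> n \<longrightarrow>
    \<delta> * min (real k) (real n powr c) * real n powr (- 2 * c) *
      exp (- 2 * lambda1 * real k * real n powr (- c)) \<le> avg_degree_prob M A n (int k)"
  proof (eventually_elim, intro allI impI)
    case (elim n)
    fix M :: "'w measure" and A and k :: nat
    assume G: "MECLTG M A n (omega1 n) (lambda0 / real n) (1 - lambda1 * real n powr (- c))"
      and k: "1 \<le> k" "4 * k \<le> n"
    let ?q = "lambda1 * real n powr (- c)" and ?m = "min (real k) (real n powr c)"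
    have n: "real n > 0" using elim(5) by linarith
    have m: "1 \<le> ?m" "?m \<le> real k" "?m \<le> real n powr c"
      using k elim(5) assms by (auto simp: ge_one_powr_ge_zero)
    define x where "x = \<epsilon> * ?m * real n powr (1 - c)"
    have "\<epsilon> * 1 * real n powr (1 - c) \<le> x"
      unfolding x_def using m \<epsilon> by (intro mult_mono) auto
    \<comment> \<open>The margin makes \<open>I - 1 \<ge> x / 2\<close> in spite of the rounding and of the missing node 1.\<close>
    then have x4: "4 \<le> x" using elim(3) by simp
    define I where "I = nat \<lfloor>x\<rfloor>"
    have I: "real I \<le> x" "x - 1 \<le> real I" using x4 by (auto simp: I_def)
    have "x \<le> 1 / 4 * real n powr c * real n powr (1 - c)"
      unfolding x_def using m \<epsilon> by (intro mult_mono) auto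
    also have "\<dots> = real n / 4" using n by (simp flip: powr_add)
    finally have I4: "4 * I \<le> n" using I by linarith
    have p: "lambda0 / real n / ?q = lambda0 / lambda1 * real n powr (c - 1)"
      using n by (simp add: powr_minus powr_diff field_simps)
    have "real I * (lambda0 / real n / ?q) \<le> x * (lambda0 / lambda1 * real n powr (c - 1))"
      unfolding p using I assms by (intro mult_right_mono) auto
    also have "\<dots> = \<epsilon> * (lambda0 / lambda1) * ?m * (real n powr (1 - c) * real n powr (c - 1))"
      by (simp add: x_def mult_ac)
    also have "real n powr (1 - c) * real n powr (c - 1) = 1" using n by (simp flip: powr_add)
    also have "\<epsilon> * (lambda0 / lambda1) * ?m * 1 \<le> 1 / 4 * real k"
      using \<epsilon> m assms by (simp only: mult_1_right) (intro mult_mono, auto)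
    finally have small: "real I * (lambda0 / real n / ?q) \<le> real k / 4" by simp
    have "\<delta> * ?m * real n powr (- 2 * c) * exp (- 2 * lambda1 * real k * real n powr (- c)) =
        (x / 2) / real n * (lambda0 * ?q / 4 * exp (- 2 * lambda0) * exp (- 2 * ?q * real k))"
    proof -
      have "real n powr (- 2 * c) = real n powr (1 - c) / real n * real n powr (- c)"
        using n by (simp add: powr_minus powr_diff field_simps flip: powr_add)
      then show ?thesis by (simp add: \<delta>_def x_def mult_ac)
    qed
    also have "\<dots> \<le> (real I - 1) / real n *
        (lambda0 * ?q / 4 * exp (- 2 * lambda0) * exp (- 2 * ?q * real k))"
      using I x4 n assms by (intro mult_right_mono divide_right_mono mult_nonneg_nonneg) auto
    also have "\<dots> \<le> avg_degree_prob M A n (int k)"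
    proof (rule avg_degree_prob_ge[OF G _ elim(1) assms(1) elim(4) k I4 small])
      show "0 < ?q" using n assms by simp
      show "lambda0 / real n / ?q \<le> 1 / 4" unfolding p by (rule elim(2))
    qed
    finally show "\<delta> * ?m * real n powr (- 2 * c) *
      exp (- 2 * lambda1 * real k * real n powr (- c)) \<le> avg_degree_prob M A n (int k)" .
  qed
  moreover have "\<delta> > 0" using \<epsilon> assms by (simp add: \<delta>_def)
  ultimately show ?thesis by blast
qed

section \<open>Comparison with the power laws\<close>

lemma M_pow_le_1:
  assumes "n \<ge> 1"
  shows "M_pow n \<gamma> \<le> 1"
proof -
  let ?S = "\<Sum>k=1..n. real k powr (- \<gamma>)"
  have "real 1 powr (- \<gamma>) \<le> ?S" using assms by (intro member_le_sum) auto
  then have S: "1 \<le> ?S" by simp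
  have "(\<Sum>k=1..n. C * real k powr (- \<gamma>)) = C * ?S" for C by (rule sum_distrib_left[symmetric])
  then have "M_pow n \<gamma> = (THE C. C * ?S = 1)" by (simp only: M_pow_def)
  also have "\<dots> = 1 / ?S" using S by (intro the_equality) (auto simp: eq_divide_eq)
  finally have "M_pow n \<gamma> = 1 / ?S" .
  then show ?thesis using S by simp
qed

lemma M_powexp_le_exp:
  assumes "n \<ge> 1"
  shows "M_powexp n \<gamma> \<mu> \<le> exp \<mu>"
proof -
  let ?S = "\<Sum>k=1..n. real k powr (- \<gamma>) * exp (- \<mu> * real k)"
  have "real 1 powr (- \<gamma>) * exp (- \<mu> * real 1) \<le> ?S" using assms
    by (intro member_le_sum[of 1 _ "\<lambda>k. real k powr (- \<gamma>) * exp (- \<mu> * real k)"]) auto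
  then have S: "exp (- \<mu>) \<le> ?S" by simp
  then have pos: "0 < ?S" by (meson exp_gt_zero less_le_trans)
  have "(\<Sum>k=1..n. C * real k powr (- \<gamma>) * exp (- \<mu> * real k)) = C * ?S" for C
    unfolding mult.assoc by (rule sum_distrib_left[symmetric])
  then have "M_powexp n \<gamma> \<mu> = (THE C. C * ?S = 1)" by (simp only: M_powexp_def)
  also have "\<dots> = 1 / ?S" using pos by (intro the_equality) (auto simp: eq_divide_eq)
  also have "\<dots> \<le> 1 / exp (- \<mu>)" using S pos by (intro divide_left_mono) auto
  also have "\<dots> = exp \<mu>" by (simp add: exp_minus field_simps)
  finally show ?thesis .
qed

text \<open>Up to \<open>n^c\<close> the exponential factor is at least \<open>exp (- 2 * lambda1)\<close>, and the claim becomes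
  \<open>k^(1 + \<gamma>) \<ge> (exp (2 * lambda1) / \<delta>) * n^(2 * c)\<close>; the constant \<open>a\<close> makes it true at the lower end
  of the range. Beyond \<open>n^c\<close> the exponent available to the exponential factor is the gap
  \<open>c * (\<gamma> - 1)\<close> between \<open>n^(- c * \<gamma>)\<close> and \<open>n^(- c)\<close>. With the constant \<open>b\<close> the factor uses up half of it
  at the upper end, and the other half absorbs \<open>\<delta>\<close>. The factor \<open>1 / 2\<close> at the lower end leaves room for
  rounding \<open>k\<close> to an integer.\<close>

lemma eventually_power_law_le:
  fixes \<delta> lambda1 c \<gamma> :: real
  assumes "\<delta> > 0" "lambda1 > 0" "0 < c" "\<gamma> > 1"
  defines "a \<equiv> 2 * (exp (2 * lambda1) / \<delta>) powr (1 / (1 + \<gamma>))"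
    and "b \<equiv> c * (\<gamma> - 1) / (4 * lambda1)"
  shows "\<forall>\<^sub>F n :: nat in sequentially. \<forall>k :: real.
    a / 2 * real n powr (2 * c / (1 + \<gamma>)) \<le> k \<longrightarrow> k \<le> b * real n powr c * ln (real n) \<longrightarrow>
    k powr (- \<gamma>) \<le> \<delta> * min k (real n powr c) * real n powr (- 2 * c) *
      exp (- 2 * lambda1 * k * real n powr (- c))"
proof -
  let ?K = "exp (2 * lambda1) / \<delta>"
  have K: "?K > 0" using assms by simp
  have "\<forall>\<^sub>F n :: nat in sequentially. real n powr (- (c * (\<gamma> - 1) / 2)) \<le> \<delta>"
  proof -
    have "c * (\<gamma> - 1) / 2 > 0" using assms by simp
    then show ?thesis using assms(1) by real_asymp
  qed
  moreover have "\<forall>\<^sub>F n :: nat in sequentially. 1 \<le> real n" by real_asymp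
  ultimately show ?thesis
  proof (eventually_elim, intro allI impI)
    case (elim n)
    fix k :: real
    assume lo: "a / 2 * real n powr (2 * c / (1 + \<gamma>)) \<le> k"
      and hi: "k \<le> b * real n powr c * ln (real n)"
    have n: "real n > 0" using elim(2) by linarith
    have lo0: "0 < a / 2 * real n powr (2 * c / (1 + \<gamma>))"
      using n K assms(1) by (auto simp: a_def intro!: mult_pos_pos)
    then have k: "k > 0" using lo by linarith
    show "k powr (- \<gamma>) \<le> \<delta> * min k (real n powr c) * real n powr (- 2 * c) *
      exp (- 2 * lambda1 * k * real n powr (- c))"
    proof (cases "k \<le> real n powr c")
      case True
      have "?K * real n powr (2 * c) = (a / 2 * real n powr (2 * c / (1 + \<gamma>))) powr (1 + \<gamma>)"
        using K n assms by (simp add: a_def powr_mult powr_powr)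
      also have "\<dots> \<le> k powr (1 + \<gamma>)" using lo lo0 assms by (intro powr_mono2) auto
      finally have "?K * real n powr (2 * c) \<le> k powr (1 + \<gamma>)" .
      then have "exp (2 * lambda1) * real n powr (2 * c) \<le> \<delta> * (k * k powr \<gamma>)"
        using assms(1) k by (simp add: field_simps powr_add)
      then have "k powr (- \<gamma>) \<le> \<delta> * k * real n powr (- 2 * c) * exp (- 2 * lambda1)"
        using k n by (simp add: powr_minus exp_minus field_simps)
      also have "\<dots> \<le> \<delta> * k * real n powr (- 2 * c) * exp (- 2 * lambda1 * k * real n powr (- c))"
      proof -
        have "k * real n powr (- c) \<le> 1" using True n by (simp add: powr_minus field_simps)
        then have "lambda1 * (k * real n powr (- c)) \<le> lambda1"
          using assms(2) by (simp add: mult_left_le)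
        then show ?thesis using k assms(1) by (intro mult_left_mono) (auto simp: mult_ac)
      qed
      finally show ?thesis using True by (simp add: min_def)
    next
      case False
      have "k powr (- \<gamma>) \<le> (real n powr c) powr (- \<gamma>)"
        using False n assms by (intro powr_mono2') auto
      also have "\<dots> = real n powr (- (c * (\<gamma> - 1) / 2)) *
          (real n powr (- c) * real n powr (- (c * (\<gamma> - 1) / 2)))"
        by (simp add: powr_powr field_simps flip: powr_add)
      also have "\<dots> \<le> \<delta> * (real n powr (- c) * real n powr (- (c * (\<gamma> - 1) / 2)))"
        using elim(1) by (intro mult_right_mono) auto
      also have "\<dots> \<le> \<delta> * (real n powr (- c) * exp (- 2 * lambda1 * k * real n powr (- c)))"
      proof -
        have "k * real n powr (- c) \<le> (b * real n powr c * ln (real n)) * real n powr (- c)"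
          using hi by (intro mult_right_mono) auto
        also have "\<dots> = b * ln (real n)" using n by (simp add: powr_minus field_simps)
        finally have "2 * lambda1 * (k * real n powr (- c)) \<le> 2 * lambda1 * (b * ln (real n))"
          using assms(2) by (intro mult_left_mono) auto
        also have "\<dots> = c * (\<gamma> - 1) / 2 * ln (real n)" using assms(2) by (simp add: b_def field_simps)
        finally have "real n powr (- (c * (\<gamma> - 1) / 2)) \<le>
            exp (- 2 * lambda1 * k * real n powr (- c))" using n by (simp add: powr_def mult_ac)
        then show ?thesis using assms(1) by (intro mult_left_mono) auto
      qed
      also have "\<dots> = \<delta> * min k (real n powr c) * real n powr (- 2 * c) *
          exp (- 2 * lambda1 * k * real n powr (- c))"
      proof -
        have "real n powr (- c) = real n powr c * real n powr (- 2 * c)" by (simp flip: powr_add)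
        then show ?thesis using False by (simp add: min_def mult_ac)
      qed
      finally show ?thesis .
    qed
  qed
qed

text \<open>For large \<open>n\<close> the decay rate on the right is at most \<open>\<mu> / 2\<close>. The remaining
  \<open>exp (- \<mu> * k / 2)\<close> on the left is at most \<open>exp (\<mu> / 2) * n^(- 3 * c)\<close> for \<open>k\<close> in this range: \<open>n^(- 2 * c)\<close> of this
  is needed, and \<open>n^(- c)\<close> absorbs the constants.\<close>

lemma eventually_exponential_law_le:
  fixes \<delta> lambda1 c \<mu> :: real
  assumes "\<delta> > 0" "lambda1 > 0" "0 < c" "\<mu> > 0"
  shows "\<forall>\<^sub>F n :: nat in sequentially. \<forall>k :: real.
    1 \<le> k \<longrightarrow> 6 * c / \<mu> * ln (real n) - 1 \<le> k \<longrightarrow>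
    exp \<mu> * exp (- \<mu> * k) \<le> \<delta> * min k (real n powr c) * real n powr (- 2 * c) *
      exp (- 2 * lambda1 * k * real n powr (- c))"
proof -
  have "\<forall>\<^sub>F n :: nat in sequentially. 2 * lambda1 * real n powr (- c) \<le> \<mu> / 2"
    using assms by real_asymp
  moreover have "\<forall>\<^sub>F n :: nat in sequentially. exp (3 * \<mu> / 2) * real n powr (- c) \<le> \<delta>"
    using assms by real_asymp
  moreover have "\<forall>\<^sub>F n :: nat in sequentially. 1 \<le> real n" by real_asymp
  ultimately show ?thesis
  proof (eventually_elim, intro allI impI)
    case (elim n)
    fix k :: real
    assume k: "1 \<le> k" "6 * c / \<mu> * ln (real n) - 1 \<le> k"
    have n: "real n > 0" using elim(3) by linarith
    have m: "1 \<le> min k (real n powr c)"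
      using k elim(3) assms by (auto simp: ge_one_powr_ge_zero)
    have tail: "exp (- \<mu> * k / 2) \<le> exp (- 2 * lambda1 * k * real n powr (- c))"
      using mult_right_mono[OF elim(1), of k] k by (simp add: mult_ac)
    have "\<mu> / 2 * (6 * c / \<mu> * ln (real n) - 1) \<le> \<mu> / 2 * k"
      using k assms by (intro mult_left_mono) auto
    moreover have "\<mu> / 2 * (6 * c / \<mu> * ln (real n) - 1) = 3 * (c * ln (real n)) - \<mu> / 2"
      using assms by (simp add: field_simps)
    ultimately have "\<mu> + (- \<mu> * k / 2) \<le> 3 * \<mu> / 2 + (- c * ln (real n)) + (- 2 * c * ln (real n))"
      by simp
    then have "exp \<mu> * exp (- \<mu> * k / 2) \<le> exp (3 * \<mu> / 2) * real n powr (- c) * real n powr (- 2 * c)"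
      using n by (simp add: powr_def flip: exp_add)
    also have "\<dots> \<le> \<delta> * real n powr (- 2 * c)" using elim(2) by (intro mult_right_mono) auto
    also have "\<dots> \<le> \<delta> * min k (real n powr c) * real n powr (- 2 * c)"
      using m assms by (intro mult_right_mono) (auto simp del: min_less_iff_conj)
    finally have "exp \<mu> * exp (- \<mu> * k / 2) \<le> \<delta> * min k (real n powr c) * real n powr (- 2 * c)" .
    from mult_mono[OF this tail]
    have "exp \<mu> * exp (- \<mu> * k / 2) * exp (- \<mu> * k / 2) \<le>
        \<delta> * min k (real n powr c) * real n powr (- 2 * c) *
        exp (- 2 * lambda1 * k * real n powr (- c))"
      using k assms by simp
    moreover have "exp (- \<mu> * k) = exp (- \<mu> * k / 2) * exp (- \<mu> * k / 2)" by (simp flip: exp_add)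
    ultimately show "exp \<mu> * exp (- \<mu> * k) \<le> \<delta> * min k (real n powr c) * real n powr (- 2 * c) *
      exp (- 2 * lambda1 * k * real n powr (- c))" by (simp add: mult_ac)
  qed
qed

theorem theorem7p1:
  fixes lambda0 lambda1 c \<gamma> \<mu> :: real
  assumes "lambda0 \<ge> 1" and "lambda1 > 0" and "0 < c" and "c < 1 / 2"
    and "\<gamma> > 1" and "\<mu> > 0"
  shows "\<exists>a0 b0 c0 d0 :: real. a0 > 0 \<and> b0 > 0 \<and> c0 > 0 \<and> d0 > 0 \<and>
    (\<forall>\<^sub>F n :: nat in sequentially.
      \<forall>(M :: 'w measure) A.
        MECLTG M A n (omega1 n) (lambda0 / real n) (1 - lambda1 * real n powr (- c)) \<longrightarrow>
        {k :: int. \<lfloor>a0 * real n powr (2 * c / (1 + \<gamma>))\<rfloor> \<le> k \<and> k \<le> \<lfloor>b0 * real n powr c * ln (real n)\<rfloor>}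
          \<subseteq> A_set M A n \<gamma> \<and>
        {k :: int. \<lfloor>c0 * ln (real n)\<rfloor> \<le> k \<and> k \<le> \<lfloor>d0 * real n\<rfloor>}
          \<subseteq> B_set M A n \<gamma> \<mu>)"
proof -
  obtain \<delta> where \<delta>: "\<delta> > 0" and avg: "\<forall>\<^sub>F n :: nat in sequentially. \<forall>(M :: 'w measure) A k.
    MECLTG M A n (omega1 n) (lambda0 / real n) (1 - lambda1 * real n powr (- c)) \<longrightarrow>
    1 \<le> k \<longrightarrow> 4 * k \<le> n \<longrightarrow>
    \<delta> * min (real k) (real n powr c) * real n powr (- 2 * c) *
      exp (- 2 * lambda1 * real k * real n powr (- c)) \<le> avg_degree_prob M A n (int k)"
    using eventually_avg_degree_prob_ge[of lambda0 lambda1 c] assms by auto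
  define a where "a = 2 * (exp (2 * lambda1) / \<delta>) powr (1 / (1 + \<gamma>))"
  define b where "b = c * (\<gamma> - 1) / (4 * lambda1)"
  have pos: "a > 0" "b > 0" "6 * c / \<mu> > 0" using assms \<delta> by (auto simp: a_def b_def)
  have e: "2 * c / (1 + \<gamma>) > 0" using assms by simp
  note avg
  moreover have "\<forall>\<^sub>F n :: nat in sequentially. \<forall>k :: real.
      a / 2 * real n powr (2 * c / (1 + \<gamma>)) \<le> k \<longrightarrow> k \<le> b * real n powr c * ln (real n) \<longrightarrow>
      k powr (- \<gamma>) \<le> \<delta> * min k (real n powr c) * real n powr (- 2 * c) *
        exp (- 2 * lambda1 * k * real n powr (- c))"
    unfolding a_def b_def using \<delta> assms by (intro eventually_power_law_le) auto
  moreover have "\<forall>\<^sub>F n :: nat in sequentially. \<forall>k :: real.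
      1 \<le> k \<longrightarrow> 6 * c / \<mu> * ln (real n) - 1 \<le> k \<longrightarrow>
      exp \<mu> * exp (- \<mu> * k) \<le> \<delta> * min k (real n powr c) * real n powr (- 2 * c) *
        exp (- 2 * lambda1 * k * real n powr (- c))"
    using \<delta> assms by (intro eventually_exponential_law_le) auto
  moreover have "\<forall>\<^sub>F n :: nat in sequentially. 2 \<le> a * real n powr (2 * c / (1 + \<gamma>))"
    using pos e by real_asymp
  moreover have "\<forall>\<^sub>F n :: nat in sequentially. 4 * (b * real n powr c * ln (real n)) \<le> real n"
    using pos assms by real_asymp
  moreover have "\<forall>\<^sub>F n :: nat in sequentially. 1 \<le> 6 * c / \<mu> * ln (real n)"
    using pos(3) by real_asymp
  moreover have "\<forall>\<^sub>F n :: nat in sequentially. 1 \<le> n" by (rule eventually_ge_at_top)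
  ultimately have "\<forall>\<^sub>F n :: nat in sequentially. \<forall>(M :: 'w measure) A.
      MECLTG M A n (omega1 n) (lambda0 / real n) (1 - lambda1 * real n powr (- c)) \<longrightarrow>
      {k :: int. \<lfloor>a * real n powr (2 * c / (1 + \<gamma>))\<rfloor> \<le> k \<and> k \<le> \<lfloor>b * real n powr c * ln (real n)\<rfloor>}
        \<subseteq> A_set M A n \<gamma> \<and>
      {k :: int. \<lfloor>6 * c / \<mu> * ln (real n)\<rfloor> \<le> k \<and> k \<le> \<lfloor>1 / 4 * real n\<rfloor>}
        \<subseteq> B_set M A n \<gamma> \<mu>"
  proof (eventually_elim, intro allI impI)
    case (elim n)
    fix M :: "'w measure" and A
    assume G: "MECLTG M A n (omega1 n) (lambda0 / real n) (1 - lambda1 * real n powr (- c))"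
    let ?low = "\<lambda>k. \<delta> * min k (real n powr c) * real n powr (- 2 * c) *
      exp (- 2 * lambda1 * k * real n powr (- c))"
    have avg: "?low (real_of_int k) \<le> avg_degree_prob M A n k" if "1 \<le> k" "4 * k \<le> int n" for k
      using elim(1) G that by (cases k rule: int_cases2) auto
    show "{k :: int. \<lfloor>a * real n powr (2 * c / (1 + \<gamma>))\<rfloor> \<le> k \<and> k \<le> \<lfloor>b * real n powr c * ln (real n)\<rfloor>}
        \<subseteq> A_set M A n \<gamma> \<and>
      {k :: int. \<lfloor>6 * c / \<mu> * ln (real n)\<rfloor> \<le> k \<and> k \<le> \<lfloor>1 / 4 * real n\<rfloor>}
        \<subseteq> B_set M A n \<gamma> \<mu>"
    proof (intro conjI subsetI)
      fix k assume "k \<in> {k :: int. \<lfloor>a * real n powr (2 * c / (1 + \<gamma>))\<rfloor> \<le> k \<and>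
        k \<le> \<lfloor>b * real n powr c * ln (real n)\<rfloor>}"
      then have lo: "\<lfloor>a * real n powr (2 * c / (1 + \<gamma>))\<rfloor> \<le> k"
        and hi: "real_of_int k \<le> b * real n powr c * ln (real n)" by (auto simp: le_floor_iff)
      have "a * real n powr (2 * c / (1 + \<gamma>)) - 1 \<le> real_of_int k" using lo by linarith
      then have lo': "a / 2 * real n powr (2 * c / (1 + \<gamma>)) \<le> real_of_int k"
        using elim(4) by simp
      have k: "1 \<le> k" "4 * k \<le> int n" using lo' hi elim(4,5) by linarith+
      have "M_pow n \<gamma> * real_of_int k powr (- \<gamma>) \<le> 1 * real_of_int k powr (- \<gamma>)"
        using M_pow_le_1[OF elim(7)] by (intro mult_right_mono) auto
      also have "\<dots> \<le> ?low (real_of_int k)" using elim(2) lo' hi by simp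
      also have "\<dots> \<le> avg_degree_prob M A n k" by (rule avg[OF k])
      finally show "k \<in> A_set M A n \<gamma>" using k by (simp add: A_set_def)
    next
      fix k assume "k \<in> {k :: int. \<lfloor>6 * c / \<mu> * ln (real n)\<rfloor> \<le> k \<and> k \<le> \<lfloor>1 / 4 * real n\<rfloor>}"
      then have lo: "\<lfloor>6 * c / \<mu> * ln (real n)\<rfloor> \<le> k"
        and hi: "real_of_int k \<le> 1 / 4 * real n" by (auto simp: le_floor_iff)
      have "1 \<le> \<lfloor>6 * c / \<mu> * ln (real n)\<rfloor>" using elim(6) by (simp add: le_floor_iff)
      then have k: "1 \<le> k" "4 * k \<le> int n" using lo hi by linarith+
      have lo': "6 * c / \<mu> * ln (real n) - 1 \<le> real_of_int k" using lo by linarith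
      have "M_powexp n \<gamma> \<mu> * real_of_int k powr (- \<gamma>) \<le> exp \<mu> * 1"
      proof (rule mult_mono)
        show "real_of_int k powr (- \<gamma>) \<le> 1"
          using powr_mono2'[of "- \<gamma>" 1 "real_of_int k"] k assms by simp
      qed (use M_powexp_le_exp[OF elim(7)] in auto)
      then have "M_powexp n \<gamma> \<mu> * real_of_int k powr (- \<gamma>) * exp (- \<mu> * real_of_int k)
          \<le> exp \<mu> * exp (- \<mu> * real_of_int k)" by simp
      also have "\<dots> \<le> ?low (real_of_int k)" using elim(3) k lo' by simp
      also have "\<dots> \<le> avg_degree_prob M A n k" by (rule avg[OF k])
      finally show "k \<in> B_set M A n \<gamma> \<mu>" using k by (simp add: B_set_def)
    qed
  qed
  then show ?thesis
    using pos by (intro exI[of _ a] exI[of _ b] exI[of _ "6 * c / \<mu>"] exI[of _ "1 / 4"]) auto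
qed

end
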